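(* Let $n\geq 2$ and let $G$ be a graph. If $M(M(K_n))$ is a subgraph of $G$, then $\chi(K_m^G)=m$ for every positive integer $m\leq n+1$.
   Context: All graphs are finite, undirected, without multiple edges; loops are allowed unless the graph is called simple (no loops). $E(G)\subseteq V(G)\times V(G)$ is the symmetric edge relation, and $x \sim y$ means $(x,y)\in E(G)$. A subgraph $H$ of $G$ is a graph with $V(H)\subseteq V(G)$, $E(H)\subseteq E(G)$. $K_n$ is the complete graph on $\{1,\dots,n\}$ (no loops). The chromatic number $\chi(G)$ of a simple graph $G$ is the least $n$ such that there is a graph homomorphism (edge-preserving vertex map) $G\to K_n$. Categorical product: $G\times H$ has vertex set $V(G)\times V(H)$, with $(g,h)\sim(g',h')$ iff $g\sim g'$ in $G$ and $h\sim h'$ in $H$. Mycielskian: let $L_2(\{0\})$ be the graph with vertex set $\{0,1,2\}$, edges $0\sim1$, $1\sim2$ and a loop at $0$. For a graph $G$, the Mycielskian $M(G)$ is the quotient of $G\times L_2(\{0\})$ identifying all vertices with second coordinate $2$ to a single vertex (two vertices of the quotient are adjacent iff some representatives are adjacent). Exponential graph: $H^G$ has as vertices all set maps $V(G)\to V(H)$, and $f\sim f'$ in $H^G$ iff $v\sim v'$ in $G$ implies $f(v)\sim f'(v')$ in $H$. *)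

theory Defs
  imports "Graph_Theory.Graph_Theory" "HOL-Library.FuncSet" "HOL-Library.Extended_Nat"
begin

text \<open>
  A graph is a \<^typ>\<open>'a pair_pre_digraph\<close> \<open>G\<close> with vertex set \<^term>\<open>pverts G\<close> and edge relation
  \<^term>\<open>parcs G\<close>. The locale predicate \<^const>\<open>pair_pseudo_graph\<close> says that it is finite, that the
  edge relation is contained in \<^term>\<open>pverts G \<times> pverts G\<close> and that it is symmetric. Loops are
  allowed.
\<close>

definition complete_graph :: "nat \<Rightarrow> nat pair_pre_digraph" where
  "complete_graph n = \<lparr>pverts = {1..n}, parcs = {(i, j). i \<in> {1..n} \<and> j \<in> {1..n} \<and> i \<noteq> j}\<rparr>"

definition graph_hom :: "('a \<Rightarrow> 'b) \<Rightarrow> 'a pair_pre_digraph \<Rightarrow> 'b pair_pre_digraph \<Rightarrow> bool" where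
  "graph_hom f G H \<longleftrightarrow>
     f \<in> pverts G \<rightarrow> pverts H \<and> (\<forall>x y. (x, y) \<in> parcs G \<longrightarrow> (f x, f y) \<in> parcs H)"

text \<open>
  The least \<open>n\<close> with a homomorphism to the complete graph on \<open>n\<close> vertices. A graph with a loop has no
  such homomorphism and gets the value \<^term>\<open>\<infinity>\<close>, so \<open>chromatic_number G = enat m\<close> entails that
  \<open>G\<close> is simple.
\<close>

definition chromatic_number :: "'a pair_pre_digraph \<Rightarrow> enat" where
  "chromatic_number G = (INF n \<in> {n. \<exists>f. graph_hom f G (complete_graph n)}. enat n)"

definition cat_product ::
    "'a pair_pre_digraph \<Rightarrow> 'b pair_pre_digraph \<Rightarrow> ('a \<times> 'b) pair_pre_digraph" where
  "cat_product G H =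
     \<lparr>pverts = pverts G \<times> pverts H,
      parcs = {((g, h), (g', h')). (g, g') \<in> parcs G \<and> (h, h') \<in> parcs H}\<rparr>"

definition quotient_graph :: "'a pair_pre_digraph \<Rightarrow> 'a rel \<Rightarrow> 'a set pair_pre_digraph" where
  "quotient_graph G r =
     \<lparr>pverts = pverts G // r,
      parcs = {(X, Y). X \<in> pverts G // r \<and> Y \<in> pverts G // r \<and>
                       (\<exists>x\<in>X. \<exists>y\<in>Y. (x, y) \<in> parcs G)}\<rparr>"

text \<open>The path \<open>0 \<sim> 1 \<sim> 2\<close> with a loop at \<open>0\<close>.\<close>

definition looped_path :: "nat pair_pre_digraph" where
  "looped_path = \<lparr>pverts = {0, 1, 2}, parcs = {(0, 0), (0, 1), (1, 0), (1, 2), (2, 1)}\<rparr>"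

definition mycielskian :: "'a pair_pre_digraph \<Rightarrow> ('a \<times> nat) set pair_pre_digraph" where
  "mycielskian G =
     (let P = cat_product G looped_path
      in quotient_graph P
           {(x, y). x \<in> pverts P \<and> y \<in> pverts P \<and> (x = y \<or> snd x = 2 \<and> snd y = 2)})"

text \<open>
  \<open>exp_graph H G\<close> is the exponential graph with base \<open>H\<close> and exponent \<open>G\<close>. The extensional
  function space has exactly one element for each map from \<^term>\<open>pverts G\<close> to \<^term>\<open>pverts H\<close>.
\<close>

definition exp_graph :: "'b pair_pre_digraph \<Rightarrow> 'a pair_pre_digraph \<Rightarrow> ('a \<Rightarrow> 'b) pair_pre_digraph" where
  "exp_graph H G =
     \<lparr>pverts = pverts G \<rightarrow>\<^sub>E pverts H,
      parcs = {(f, f'). f \<in> pverts G \<rightarrow>\<^sub>E pverts H \<and> f' \<in> pverts G \<rightarrow>\<^sub>E pverts H \<and>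
                        (\<forall>v v'. (v, v') \<in> parcs G \<longrightarrow> (f v, f' v') \<in> parcs H)}\<rparr>"

end

theory Submission
  imports Defs "HOL-Combinatorics.Permutations"
begin

text \<open>
  The constant maps form a copy of \<open>K\<^sub>m\<close> in \<open>K\<^sub>m\<^sup>G\<close>, so at least \<open>m\<close> colours are needed
  (\<open>exp_graph_colours_ge\<close>). It remains to colour \<open>K\<^sub>m\<^sup>G\<close> with \<open>m\<close> colours, and the colour of
  a map \<open>f\<close> will be read off from its values on the copy of \<open>M(M(K\<^sub>n))\<close> alone. For \<open>m = 1\<close> there is
  no edge to take care of, and for \<open>m = 2\<close> the value at one vertex of an odd cycle will do. So let
  \<open>m \<ge> 3\<close>, and keep only the first \<open>m - 1 \<le> n\<close> vertices \<open>v i\<close> of the clique, with copies \<open>v' i\<close> in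
  the inner Mycielskian.

  A colour of \<open>f\<close> that occurs at some \<open>v i\<close> and also at some \<open>v j\<close> or \<open>v' j\<close> with \<open>j \<noteq> i\<close> is
  avoided on the whole clique by every neighbour of \<open>f\<close>: each \<open>v k\<close> is adjacent to one of the two
  places (\<open>clash_avoided\<close>). If such a colour exists, \<open>f\<close> receives it. As long as every other map
  also gets one of its own values on the clique, edges at \<open>f\<close> are then properly coloured.

  If there is no such colour, \<open>f\<close> is injective on the \<open>m - 1\<close> clique vertices and misses one colour, the
  hole. Listing the values with the hole in the last place gives a permutation of the colours, the
  arrangement of \<open>f\<close>. Along an edge between two such maps the arrangement either stays the same or
  one value is exchanged with the hole, as in a sliding puzzle (\<open>arrangement_step\<close>). Moreover
  \<open>f (v' j)\<close> is \<open>f (v j)\<close> or the hole; call \<open>f\<close> faithful if it is always \<open>f (v j)\<close>.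
  The rest of \<open>M(M(K\<^sub>n))\<close> forces a relation between both data (\<open>clash_free_arc_side\<close>): faithfulness
  changes along an edge exactly when the arrangement stays the same, while the parity of the arrangement
  changes exactly when a value slides. Hence the exclusive or of parity and faithfulness changes along
  every edge, and \<open>f\<close> may be given the colour \<open>f (v 1)\<close> or \<open>f (v 2)\<close> according to it:
  \<open>f (v 1) \<noteq> g (v 2)\<close> for adjacent \<open>f\<close> and \<open>g\<close> because \<open>v 1\<close> and \<open>v 2\<close> are adjacent.

  The forced relation is where the two apexes enter. Both lemmas behind it
  (\<open>no_arc_if_copies_unmoved\<close>, \<open>no_arc_if_both_unfaithful\<close>) follow the values from \<open>z\<close> through the
  copies up to \<open>w\<close>, where no colour is left.
\<close>

section \<open>Complete graphs and exponential graphs\<close>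

lemma complete_graph_simps [simp]:
  "pverts (complete_graph m) = {1..m}"
  "(i, j) \<in> parcs (complete_graph m) \<longleftrightarrow> i \<in> {1..m} \<and> j \<in> {1..m} \<and> i \<noteq> j"
  by (auto simp: complete_graph_def)

lemma pverts_exp_graph [simp]: "pverts (exp_graph H G) = pverts G \<rightarrow>\<^sub>E pverts H"
  by (simp add: exp_graph_def)

lemma exp_graph_arcD:
  assumes "(f, g) \<in> parcs (exp_graph H G)"
  shows "f \<in> pverts G \<rightarrow>\<^sub>E pverts H" and "g \<in> pverts G \<rightarrow>\<^sub>E pverts H"
    and "(x, x') \<in> parcs G \<Longrightarrow> (f x, g x') \<in> parcs H"
  using assms by (auto simp: exp_graph_def)

lemma chromatic_number_eqI:
  assumes "graph_hom F G (complete_graph m)"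
    and "\<And>k F'. graph_hom F' G (complete_graph k) \<Longrightarrow> m \<le> k"
  shows "chromatic_number G = enat m"
  unfolding chromatic_number_def
proof (rule antisym)
  show "(INF n \<in> {n. \<exists>f. graph_hom f G (complete_graph n)}. enat n) \<le> enat m"
    by (rule INF_lower) (use assms(1) in blast)
  show "enat m \<le> (INF n \<in> {n. \<exists>f. graph_hom f G (complete_graph n)}. enat n)"
    by (rule INF_greatest) (use assms(2) in auto)
qed

text \<open>
  The constant maps with distinct values are pairwise adjacent, so any colouring is injective on them.
\<close>

lemma exp_graph_colours_ge:
  assumes wf: "pair_wf_digraph G"
    and F: "graph_hom F (exp_graph (complete_graph m) G) (complete_graph k)"
  shows "m \<le> k"
proof -
  define c where "c i = restrict (\<lambda>_. i) (pverts G)" for i :: nat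
  have c_in: "c i \<in> pverts (exp_graph (complete_graph m) G)" if "i \<in> {1..m}" for i
    using that by (auto simp: c_def)
  have c_arc: "(c i, c j) \<in> parcs (exp_graph (complete_graph m) G)"
    if "i \<in> {1..m}" "j \<in> {1..m}" "i \<noteq> j" for i j
    using that pair_wf_digraph.arc_fst_in_verts[OF wf] pair_wf_digraph.arc_snd_in_verts[OF wf]
    by (fastforce simp: c_def exp_graph_def)
  have "inj_on (\<lambda>i. F (c i)) {1..m}"
  proof (rule inj_onI, rule ccontr)
    fix i j assume ij: "i \<in> {1..m}" "j \<in> {1..m}" "F (c i) = F (c j)" "i \<noteq> j"
    then have "(F (c i), F (c j)) \<in> parcs (complete_graph k)"
      using F c_arc[OF ij(1,2,4)] unfolding graph_hom_def by blast
    with ij show False by simp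
  qed
  moreover have "(\<lambda>i. F (c i)) ` {1..m} \<subseteq> {1..k}"
    using F c_in by (auto simp: graph_hom_def Pi_iff simp del: pverts_exp_graph)
  ultimately have "card {1..m} \<le> card {1..k}" by (intro card_inj_on_le) auto
  then show ?thesis by simp
qed

section \<open>Vertices of a Mycielskian\<close>

text \<open>
  These sets are the equivalence classes of the vertices of \<open>G \<times> L\<^sub>2({0})\<close>: singletons
  over \<open>0\<close> and \<open>1\<close>, and one class containing everything over \<open>2\<close>.
\<close>

definition base_vertex :: "'a \<Rightarrow> ('a \<times> nat) set" where
  "base_vertex x = {(x, 0)}"

definition copy_vertex :: "'a \<Rightarrow> ('a \<times> nat) set" where
  "copy_vertex x = {(x, 1)}"

definition apex :: "'a pair_pre_digraph \<Rightarrow> ('a \<times> nat) set" where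
  "apex G = pverts G \<times> {2}"

lemma mycielskian_arcI:
  assumes "x \<in> X" "x' \<in> X'" "(x, x') \<in> parcs (cat_product G looped_path)"
    and "X \<in> pverts (mycielskian G)" "X' \<in> pverts (mycielskian G)"
  shows "(X, X') \<in> parcs (mycielskian G)"
  using assms by (auto simp: mycielskian_def quotient_graph_def Let_def)

lemma mycielskian_vertices:
  assumes "x \<in> pverts G"
  shows "base_vertex x \<in> pverts (mycielskian G)" "copy_vertex x \<in> pverts (mycielskian G)"
    and "apex G \<in> pverts (mycielskian G)"
proof -
  define P where "P = cat_product G looped_path"
  define r where "r = {(s, t). s \<in> pverts P \<and> t \<in> pverts P \<and> (s = t \<or> snd s = 2 \<and> snd t = 2)}"
  have verts: "pverts (mycielskian G) = pverts P // r"
    by (simp add: mycielskian_def Let_def P_def r_def quotient_graph_def)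
  have P: "pverts P = pverts G \<times> {0, 1, 2}"
    by (simp add: P_def cat_product_def looped_path_def)
  have "base_vertex x = r `` {(x, 0)}" "copy_vertex x = r `` {(x, 1)}" "apex G = r `` {(x, 2)}"
    using assms by (auto simp: base_vertex_def copy_vertex_def apex_def r_def P)
  then show "base_vertex x \<in> pverts (mycielskian G)" "copy_vertex x \<in> pverts (mycielskian G)"
    "apex G \<in> pverts (mycielskian G)"
    using assms by (auto simp: verts P intro!: quotientI)
qed

lemma mycielskian_arcs:
  assumes "(x, x') \<in> parcs G" "x \<in> pverts G" "x' \<in> pverts G"
  shows "(base_vertex x, base_vertex x') \<in> parcs (mycielskian G)"
    and "(copy_vertex x, base_vertex x') \<in> parcs (mycielskian G)"
    and "(copy_vertex x, apex G) \<in> parcs (mycielskian G)"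
proof -
  note verts = mycielskian_vertices[OF assms(2)] mycielskian_vertices[OF assms(3)]
  note defs = base_vertex_def copy_vertex_def apex_def cat_product_def looped_path_def
  show "(base_vertex x, base_vertex x') \<in> parcs (mycielskian G)"
    by (rule mycielskian_arcI[of "(x, 0)" _ "(x', 0)"]) (use verts assms in \<open>auto simp: defs\<close>)
  show "(copy_vertex x, base_vertex x') \<in> parcs (mycielskian G)"
    by (rule mycielskian_arcI[of "(x, 1)" _ "(x', 0)"]) (use verts assms in \<open>auto simp: defs\<close>)
  show "(copy_vertex x, apex G) \<in> parcs (mycielskian G)"
    by (rule mycielskian_arcI[of "(x, 1)" _ "(x', 2)"]) (use verts assms in \<open>auto simp: defs\<close>)
qed

section \<open>Graphs containing a twice iterated Mycielskian of a clique\<close>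

text \<open>
  The image of \<open>M(M(K\<^sub>n))\<close> in \<open>G\<close>: \<open>v\<close> is the clique, \<open>v'\<close> its copies and \<open>z\<close> the apex of the
  inner Mycielskian; \<open>u'\<close> and \<open>y\<close> are the copies of \<open>v'\<close> and \<open>z\<close>, \<open>u\<close> those of \<open>v\<close>, and \<open>w\<close> is the
  apex of the outer Mycielskian.
\<close>

locale double_mycielskian_of_clique = pair_pseudo_graph G
  for G :: "'v pair_pre_digraph" +
  fixes n :: nat and v v' u u' :: "nat \<Rightarrow> 'v" and z y w :: 'v
  assumes two_le_n: "2 \<le> n"
    and v_v: "i \<in> {1..n} \<Longrightarrow> j \<in> {1..n} \<Longrightarrow> i \<noteq> j \<Longrightarrow> (v i, v j) \<in> parcs G"
    and v'_v: "i \<in> {1..n} \<Longrightarrow> j \<in> {1..n} \<Longrightarrow> i \<noteq> j \<Longrightarrow> (v' i, v j) \<in> parcs G"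
    and v'_z: "i \<in> {1..n} \<Longrightarrow> (v' i, z) \<in> parcs G"
    and u_v: "i \<in> {1..n} \<Longrightarrow> j \<in> {1..n} \<Longrightarrow> i \<noteq> j \<Longrightarrow> (u i, v j) \<in> parcs G"
    and u_v': "i \<in> {1..n} \<Longrightarrow> j \<in> {1..n} \<Longrightarrow> i \<noteq> j \<Longrightarrow> (u i, v' j) \<in> parcs G"
    and u'_v: "i \<in> {1..n} \<Longrightarrow> j \<in> {1..n} \<Longrightarrow> i \<noteq> j \<Longrightarrow> (u' i, v j) \<in> parcs G"
    and u'_z: "i \<in> {1..n} \<Longrightarrow> (u' i, z) \<in> parcs G"
    and y_v': "i \<in> {1..n} \<Longrightarrow> (y, v' i) \<in> parcs G"
    and u_w: "i \<in> {1..n} \<Longrightarrow> (u i, w) \<in> parcs G"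
    and u'_w: "i \<in> {1..n} \<Longrightarrow> (u' i, w) \<in> parcs G"
    and y_w: "(y, w) \<in> parcs G"
begin

lemma arc_sym: "(x, x') \<in> parcs G \<Longrightarrow> (x', x) \<in> parcs G"
  using pair_sym_arcs by (auto simp: symmetric_def elim: symE)

lemma vertices:
  "i \<in> {1..n} \<Longrightarrow> v i \<in> pverts G" "i \<in> {1..n} \<Longrightarrow> v' i \<in> pverts G"
  "i \<in> {1..n} \<Longrightarrow> u i \<in> pverts G" "i \<in> {1..n} \<Longrightarrow> u' i \<in> pverts G"
  "z \<in> pverts G" "y \<in> pverts G" "w \<in> pverts G"
proof -
  have arc: "x \<in> pverts G \<and> x' \<in> pverts G" if "(x, x') \<in> parcs G" for x x'
    using arc_fst_in_verts[OF that] arc_snd_in_verts[OF that] by simp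
  have one: "1 \<in> {1..n}" using two_le_n by simp
  show "i \<in> {1..n} \<Longrightarrow> v' i \<in> pverts G" using arc[OF v'_z] by simp
  show "i \<in> {1..n} \<Longrightarrow> u i \<in> pverts G" using arc[OF u_w] by simp
  show "i \<in> {1..n} \<Longrightarrow> u' i \<in> pverts G" using arc[OF u'_w] by simp
  show "z \<in> pverts G" using arc[OF v'_z[OF one]] by simp
  show "y \<in> pverts G" "w \<in> pverts G" using arc[OF y_w] by simp_all
  show "v i \<in> pverts G" if i: "i \<in> {1..n}"
  proof -
    have "(if i = 1 then 2 else 1) \<in> {1..n}" "i \<noteq> (if i = 1 then 2 else 1)"
      using two_le_n by auto
    then show ?thesis using arc[OF v_v[OF i]] by simp
  qed
qed

end

lemma double_mycielskian_of_cliqueI: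
  assumes G: "pair_pseudo_graph G" and n: "2 \<le> n"
    and \<phi>: "\<And>s t. (s, t) \<in> parcs (mycielskian (mycielskian (complete_graph n)))
      \<Longrightarrow> (\<phi> s, \<phi> t) \<in> parcs G"
  defines "M \<equiv> mycielskian (complete_graph n)"
  shows "double_mycielskian_of_clique G n
    (\<lambda>i. \<phi> (base_vertex (base_vertex i))) (\<lambda>i. \<phi> (base_vertex (copy_vertex i)))
    (\<lambda>i. \<phi> (copy_vertex (base_vertex i))) (\<lambda>i. \<phi> (copy_vertex (copy_vertex i)))
    (\<phi> (base_vertex (apex (complete_graph n)))) (\<phi> (copy_vertex (apex (complete_graph n))))
    (\<phi> (apex M))"
proof -
  let ?K = "complete_graph n"
  interpret pair_pseudo_graph G by fact
  have other: "\<exists>j. j \<in> {1..n} \<and> i \<noteq> j" for i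
    using n by (intro exI[of _ "if i = 1 then 2 else 1"]) auto
  have arcs_K: "(i, j) \<in> parcs ?K" "i \<in> pverts ?K" "j \<in> pverts ?K"
    if "i \<in> {1..n}" "j \<in> {1..n}" "i \<noteq> j" for i j
    using that by auto
  have verts_M: "base_vertex i \<in> pverts M" "copy_vertex i \<in> pverts M" "apex ?K \<in> pverts M"
    if "i \<in> {1..n}" for i
    using mycielskian_vertices[of i ?K] that by (auto simp: M_def)
  have arcs_M: "(base_vertex i, base_vertex j) \<in> parcs M" "(copy_vertex i, base_vertex j) \<in> parcs M"
    if "i \<in> {1..n}" "j \<in> {1..n}" "i \<noteq> j" for i j
    using mycielskian_arcs[OF arcs_K[OF that]] by (auto simp: M_def)
  have arcs_M_apex: "(copy_vertex i, apex ?K) \<in> parcs M" if "i \<in> {1..n}" for i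
  proof -
    obtain j where "j \<in> {1..n}" "i \<noteq> j" using other by blast
    with that show ?thesis using mycielskian_arcs[OF arcs_K[of i j]] by (simp add: M_def)
  qed
  have arcs_M': "(base_vertex i, copy_vertex j) \<in> parcs M" "(apex ?K, copy_vertex j) \<in> parcs M"
    if "i \<in> {1..n}" "j \<in> {1..n}" "i \<noteq> j" for i j
  proof -
    have "(base_vertex i, copy_vertex j) \<in> parcs (mycielskian ?K)"
      by (rule mycielskian_arcI[of "(i, 0)" _ "(j, 1)"])
        (use that verts_M in \<open>auto simp: M_def base_vertex_def copy_vertex_def cat_product_def
          looped_path_def complete_graph_def\<close>)
    moreover have "(apex ?K, copy_vertex j) \<in> parcs (mycielskian ?K)"
      by (rule mycielskian_arcI[of "(i, 2)" _ "(j, 1)"])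
        (use that verts_M in \<open>auto simp: M_def apex_def copy_vertex_def cat_product_def
          looped_path_def complete_graph_def\<close>)
    ultimately show "(base_vertex i, copy_vertex j) \<in> parcs M" "(apex ?K, copy_vertex j) \<in> parcs M"
      by (simp_all add: M_def)
  qed
  have \<phi>M: "(\<phi> (base_vertex s), \<phi> (base_vertex t)) \<in> parcs G"
    "(\<phi> (copy_vertex s), \<phi> (base_vertex t)) \<in> parcs G"
    "(\<phi> (copy_vertex s), \<phi> (apex M)) \<in> parcs G"
    if "(s, t) \<in> parcs M" "s \<in> pverts M" "t \<in> pverts M" for s t
    using mycielskian_arcs[OF that] \<phi> by (auto simp: M_def)
  have verts_of_arc: "s \<in> pverts M \<and> t \<in> pverts M" if "(s, t) \<in> parcs M" for s t
    using that by (auto simp: M_def mycielskian_def quotient_graph_def Let_def)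
  note \<phi>M' = \<phi>M[OF _ conjunct1[OF verts_of_arc] conjunct2[OF verts_of_arc]]
  have one: "1 \<in> {1..n}" "2 \<in> {1..n}" using n by auto
  show ?thesis
  proof unfold_locales
    fix i j assume ij: "i \<in> {1..n}" "j \<in> {1..n}" "i \<noteq> j"
    show "(\<phi> (base_vertex (base_vertex i)), \<phi> (base_vertex (base_vertex j))) \<in> parcs G"
      "(\<phi> (base_vertex (copy_vertex i)), \<phi> (base_vertex (base_vertex j))) \<in> parcs G"
      "(\<phi> (copy_vertex (base_vertex i)), \<phi> (base_vertex (base_vertex j))) \<in> parcs G"
      "(\<phi> (copy_vertex (base_vertex i)), \<phi> (base_vertex (copy_vertex j))) \<in> parcs G"
      "(\<phi> (copy_vertex (copy_vertex i)), \<phi> (base_vertex (base_vertex j))) \<in> parcs G"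
      using arcs_M[OF ij] arcs_M'[OF ij] \<phi>M' by blast+
  next
    fix i assume i: "i \<in> {1..n}"
    obtain j where j: "j \<in> {1..n}" "j \<noteq> i" using other by metis
    show "(\<phi> (base_vertex (copy_vertex i)), \<phi> (base_vertex (apex ?K))) \<in> parcs G"
      "(\<phi> (copy_vertex (copy_vertex i)), \<phi> (base_vertex (apex ?K))) \<in> parcs G"
      "(\<phi> (copy_vertex (copy_vertex i)), \<phi> (apex M)) \<in> parcs G"
      using arcs_M_apex[OF i] \<phi>M' by blast+
    show "(\<phi> (copy_vertex (apex ?K)), \<phi> (base_vertex (copy_vertex i))) \<in> parcs G"
      using arcs_M'[OF j(1) i j(2)] \<phi>M' by blast
    show "(\<phi> (copy_vertex (base_vertex i)), \<phi> (apex M)) \<in> parcs G"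
      using arcs_M[OF i j(1)] j(2) \<phi>M' by blast
  next
    show "(\<phi> (copy_vertex (apex ?K)), \<phi> (apex M)) \<in> parcs G"
      using arcs_M'[OF one] \<phi>M' by fastforce
  qed (use n in simp)
qed

section \<open>Colouring the exponential graph\<close>

text \<open>
  Here \<open>m - 1 \<le> n\<close> clique vertices are used, so that a map injective on them misses exactly one
  of the \<open>m\<close> colours. The bound \<open>3 \<le> m\<close> provides the two vertices \<open>v 1\<close> and \<open>v 2\<close> between whose
  colours the final choice is made.
\<close>

locale clique_exponential = double_mycielskian_of_clique +
  fixes m :: nat
  assumes three_le_m: "3 \<le> m" and m_le: "m \<le> n + 1"
begin

abbreviation K where "K \<equiv> exp_graph (complete_graph m) G"

lemma index: "i \<in> {1..<m} \<Longrightarrow> i \<in> {1..n}"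
  using m_le by auto

lemma colour_in: "f \<in> pverts K \<Longrightarrow> x \<in> pverts G \<Longrightarrow> f x \<in> {1..m}"
  by (auto simp: PiE_iff)

lemma arc_avoids:
  assumes "(f, g) \<in> parcs K" "(x, x') \<in> parcs G"
  shows "f x \<noteq> g x'" "f x' \<noteq> g x"
  using exp_graph_arcD(3)[OF assms] exp_graph_arcD(3)[OF assms(1) arc_sym[OF assms(2)]]
  by simp_all

lemma arc_vertices: "(f, g) \<in> parcs K \<Longrightarrow> f \<in> pverts K \<and> g \<in> pverts K"
  unfolding pverts_exp_graph using exp_graph_arcD(1,2) by blast

lemma arc_flip:
  assumes "(f, g) \<in> parcs K" shows "(g, f) \<in> parcs K"
proof -
  have "(g x, f x') \<in> parcs (complete_graph m)" if "(x, x') \<in> parcs G" for x x'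
    using exp_graph_arcD(3)[OF assms arc_sym[OF that]] by auto
  then show ?thesis using exp_graph_arcD[OF assms] by (auto simp: exp_graph_def)
qed

text \<open>
  A clash is a colour that the two ends of an edge of the clique share, or that \<open>v i\<close> shares with
  a copy \<open>v' j\<close> adjacent to it.
\<close>

definition clash :: "('a \<Rightarrow> nat) \<Rightarrow> nat \<Rightarrow> bool" where
  "clash f c \<longleftrightarrow> (\<exists>i\<in>{1..<m}. \<exists>j\<in>{1..<m}. i \<noteq> j \<and> f (v i) = c \<and> (f (v j) = c \<or> f (v' j) = c))"

definition clash_free :: "('a \<Rightarrow> nat) \<Rightarrow> bool" where
  "clash_free f \<longleftrightarrow> f \<in> pverts K \<and> (\<nexists>c. clash f c)"

text \<open>
  For clash-free maps exactly one permutation qualifies, and its value at \<open>m\<close> is the colour missed by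
  \<open>f\<close> on the clique.
\<close>

definition arrangement :: "('a \<Rightarrow> nat) \<Rightarrow> nat \<Rightarrow> nat" where
  "arrangement f = (SOME P. P permutes {1..m} \<and> (\<forall>i\<in>{1..<m}. P i = f (v i)))"

definition faithful :: "('a \<Rightarrow> nat) \<Rightarrow> bool" where
  "faithful f \<longleftrightarrow> (\<forall>i\<in>{1..<m}. f (v' i) = f (v i))"

definition colouring :: "('a \<Rightarrow> nat) \<Rightarrow> nat" where
  "colouring f =
     (if \<exists>c. clash f c then SOME c. clash f c
      else if evenperm (arrangement f) = faithful f then f (v 1) else f (v 2))"

text \<open>
  The two vertices carrying a clash have no common non-neighbour on the clique.
\<close>

lemma clash_avoided:
  assumes fg: "(f, g) \<in> parcs K" and c: "clash f c" and k: "k \<in> {1..<m}"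
  shows "g (v k) \<noteq> c"
proof -
  obtain i j where ij: "i \<in> {1..<m}" "j \<in> {1..<m}" "i \<noteq> j" "f (v i) = c"
    "f (v j) = c \<or> f (v' j) = c"
    using c unfolding clash_def by blast
  show ?thesis
  proof (cases "k = i")
    case False
    then show ?thesis using arc_avoids(1)[OF fg v_v] ij index k by metis
  next
    case True
    then show ?thesis
      using arc_avoids(1)[OF fg v_v, of j k] arc_avoids(1)[OF fg v'_v, of j k] ij index k by metis
  qed
qed

lemma colouring_clique_colour:
  "\<exists>i\<in>{1..<m}. colouring f = f (v i)"
proof (cases "\<exists>c. clash f c")
  case True
  then have "clash f (colouring f)" unfolding colouring_def by (simp add: someI_ex)
  then show ?thesis unfolding clash_def by metis
next
  case False
  have "1 \<in> {1..<m}" "2 \<in> {1..<m}" using three_le_m by auto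
  moreover have "colouring f = f (v 1) \<or> colouring f = f (v 2)"
    using False by (simp add: colouring_def)
  ultimately show ?thesis by blast
qed

lemma arrangement:
  assumes "clash_free f"
  shows "arrangement f permutes {1..m}" and "\<And>i. i \<in> {1..<m} \<Longrightarrow> arrangement f i = f (v i)"
proof -
  have f: "f \<in> pverts K" using assms by (simp add: clash_free_def)
  have inj: "inj_on (\<lambda>i. f (v i)) {1..<m}"
    using assms by (auto simp: inj_on_def clash_free_def clash_def)
  have img: "(\<lambda>i. f (v i)) ` {1..<m} \<subseteq> {1..m}"
    using colour_in[OF f vertices(1)[OF index]] by blast
  have "card ((\<lambda>i. f (v i)) ` {1..<m}) < card {1..m}"
    using card_image[OF inj] three_le_m by simp
  then obtain h where h: "h \<in> {1..m}" "h \<notin> (\<lambda>i. f (v i)) ` {1..<m}"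
    using img by (metis card_mono finite_imageI finite_atLeastLessThan not_le subsetI)
  define P where "P i = (if i \<in> {1..<m} then f (v i) else if i = m then h else i)" for i
  have "P permutes {1..m}"
  proof (rule inj_imp_permutes)
    have "inj_on P (insert m {1..<m})"
      using inj h(2) by (auto simp: inj_on_def P_def)
    moreover have "insert m {1..<m} = {1..m}" using three_le_m by auto
    ultimately show "inj_on P {1..m}" by (simp only:)
    show "P i \<in> {1..m}" if "i \<in> {1..m}" for i
      using that h(1) img by (cases "i = m") (auto simp: P_def image_subset_iff)
  qed (use three_le_m in \<open>auto simp: P_def\<close>)
  then have "\<exists>P. P permutes {1..m} \<and> (\<forall>i\<in>{1..<m}. P i = f (v i))"
    by (intro exI[of _ P]) (auto simp: P_def)
  from someI_ex[OF this]
  show "arrangement f permutes {1..m}" "\<And>i. i \<in> {1..<m} \<Longrightarrow> arrangement f i = f (v i)"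
    unfolding arrangement_def by blast+
qed

lemma eq_arrangement_by_elimination:
  assumes "clash_free f" "c \<in> {1..m}"
    and "\<And>i. i \<in> {1..<m} \<Longrightarrow> i \<noteq> k \<Longrightarrow> c \<noteq> arrangement f i"
    and "k \<noteq> m \<Longrightarrow> c \<noteq> arrangement f m"
  shows "c = arrangement f k"
proof -
  obtain i where i: "i \<in> {1..m}" "c = arrangement f i"
    using permutes_image[OF arrangement(1)[OF assms(1)]] assms(2) by blast
  moreover have "i \<in> {1..<m} \<or> i = m" using i(1) by auto
  ultimately show ?thesis using assms(3,4) by metis
qed

text \<open>
  The colours other than those two occur at clique vertices adjacent to \<open>v' j\<close>.
\<close>

lemma clash_free_copy:
  assumes f: "clash_free f" and j: "j \<in> {1..<m}"
  shows "f (v' j) = f (v j) \<or> f (v' j) = arrangement f m"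
proof (rule ccontr)
  assume *: "\<not> ?thesis"
  have "f (v' j) \<noteq> arrangement f i" if "i \<in> {1..<m}" "i \<noteq> j" for i
    using f j that arrangement(2)[OF f that(1)] unfolding clash_free_def clash_def by metis
  moreover have "f (v' j) \<in> {1..m}"
    using f colour_in vertices(2) index j by (simp add: clash_free_def del: pverts_exp_graph)
  ultimately have "f (v' j) = arrangement f j"
    using * by (intro eq_arrangement_by_elimination[OF f]) auto
  then show False using * arrangement(2)[OF f j] by simp
qed

text \<open>
  If both maps show the values of \<open>f\<close> in place on the copies \<open>v'\<close>, then \<open>f z\<close> and \<open>g y\<close> must be the
  hole of \<open>f\<close>. The former forces \<open>g\<close> to show the values of \<open>f\<close> on the copies
  \<open>u'\<close>, so that \<open>g\<close> uses all colours on the neighbours of \<open>w\<close>, and \<open>f w\<close> has no colour left. Comparing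
  \<open>g\<close> on \<open>v'\<close> with \<open>f\<close> instead of \<open>g\<close> makes the lemma serve both for equal arrangements
  and for a slide.
\<close>

lemma no_arc_if_copies_unmoved:
  assumes fg: "(f, g) \<in> parcs K" and f: "clash_free f"
    and fv': "\<And>i. i \<in> {1..<m} \<Longrightarrow> f (v' i) = f (v i)"
    and gv': "\<And>i. i \<in> {1..<m} \<Longrightarrow> g (v' i) = f (v i)"
  shows False
proof -
  let ?P = "arrangement f"
  note P = arrangement(2)[OF f]
  have cf: "x \<in> pverts G \<Longrightarrow> f x \<in> {1..m}" and cg: "x \<in> pverts G \<Longrightarrow> g x \<in> {1..m}" for x
    using arc_vertices[OF fg] colour_in by blast+
  have z: "f z = ?P m"
  proof (rule eq_arrangement_by_elimination[OF f cf[OF vertices(5)]])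
    fix i assume i: "i \<in> {1..<m}"
    show "f z \<noteq> ?P i" using arc_avoids(2)[OF fg v'_z[OF index[OF i]]] gv'[OF i] P[OF i] by simp
  qed simp
  have u': "g (u' i) = ?P i" if i: "i \<in> {1..<m}" for i
  proof (rule eq_arrangement_by_elimination[OF f cg[OF vertices(4)[OF index[OF i]]]])
    fix j assume j: "j \<in> {1..<m}" "j \<noteq> i"
    show "g (u' i) \<noteq> ?P j"
      using arc_avoids(2)[OF fg u'_v[OF index[OF i] index[OF j(1)]]] j P[OF j(1)] by auto
  next
    show "g (u' i) \<noteq> ?P m" using arc_avoids(2)[OF fg u'_z[OF index[OF i]]] z by simp
  qed
  have y: "g y = ?P m"
  proof (rule eq_arrangement_by_elimination[OF f cg[OF vertices(6)]])
    fix i assume i: "i \<in> {1..<m}"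
    show "g y \<noteq> ?P i" using arc_avoids(2)[OF fg y_v'[OF index[OF i]]] fv'[OF i] P[OF i] by simp
  qed simp
  have "f w = ?P m"
  proof (rule eq_arrangement_by_elimination[OF f cf[OF vertices(7)]])
    fix i assume i: "i \<in> {1..<m}"
    show "f w \<noteq> ?P i" using arc_avoids(2)[OF fg u'_w[OF index[OF i]]] u'[OF i] by simp
  qed simp
  then show False using arc_avoids(2)[OF fg y_w] y by simp
qed

text \<open>
  When both maps use the hole on \<open>v'\<close>, it is not available at \<open>z\<close>; hence \<open>g\<close> takes the hole on
  some \<open>u'\<close>, and \<open>f w\<close> is the colour of some \<open>v k\<close>. Then \<open>g (u k)\<close> must be the hole, so that \<open>v' k\<close>
  is the only copy at which \<open>f\<close> takes the hole, and \<open>g y\<close> is forced to be the colour \<open>f w\<close> of its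
  neighbour.
\<close>

lemma no_arc_if_both_unfaithful:
  assumes fg: "(f, g) \<in> parcs K" and f: "clash_free f" and g: "clash_free g"
    and eq: "arrangement g = arrangement f"
    and nf: "\<not> faithful f" and ng: "\<not> faithful g"
  shows False
proof -
  let ?P = "arrangement f"
  note P = arrangement(2)[OF f] and Q = arrangement(2)[OF g, unfolded eq]
  have cf: "x \<in> pverts G \<Longrightarrow> f x \<in> {1..m}" and cg: "x \<in> pverts G \<Longrightarrow> g x \<in> {1..m}" for x
    using arc_vertices[OF fg] colour_in by blast+
  have elim: "\<exists>i\<in>{1..<m}. c = ?P i" if c: "c \<in> {1..m}" "c \<noteq> ?P m" for c
    using eq_arrangement_by_elimination[OF f c(1), of m] c(2) by blast
  have Pm: "?P i \<noteq> ?P m" if "i \<in> {1..<m}" for i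
    using permutes_inj[OF arrangement(1)[OF f]] that by (auto simp: inj_eq)
  obtain a where a: "a \<in> {1..<m}" "f (v' a) = ?P m"
    using nf clash_free_copy[OF f] unfolding faithful_def by blast
  obtain b where b: "b \<in> {1..<m}" "g (v' b) = ?P m"
    using ng clash_free_copy[OF g, unfolded eq] unfolding faithful_def by blast
  have fv': "f (v' i) = ?P i \<or> f (v' i) = ?P m" if "i \<in> {1..<m}" for i
    using clash_free_copy[OF f that] P[OF that] by simp
  \<comment> \<open>The hole occurs under \<open>g\<close> at \<open>v' b\<close>, a neighbour of \<open>z\<close>.\<close>
  obtain j where j: "j \<in> {1..<m}" "f z = ?P j"
    using elim[OF cf[OF vertices(5)]] arc_avoids(2)[OF fg v'_z[OF index[OF b(1)]]] b(2) by auto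
  have "g (u' j) = ?P m"
  proof (rule eq_arrangement_by_elimination[OF f cg[OF vertices(4)[OF index[OF j(1)]]]])
    fix i assume i: "i \<in> {1..<m}" 
    show "g (u' j) \<noteq> ?P i"
    proof (cases "i = j")
      case True
      then show ?thesis using arc_avoids(2)[OF fg u'_z[OF index[OF j(1)]]] j(2) by simp
    next
      case False
      then show ?thesis
        using arc_avoids(2)[OF fg u'_v[OF index[OF j(1)] index[OF i]]] P[OF i] by auto
    qed
  qed simp
  then have "f w \<noteq> ?P m" using arc_avoids(2)[OF fg u'_w[OF index[OF j(1)]]] by simp
  then obtain k where k: "k \<in> {1..<m}" "f w = ?P k" using elim[OF cf[OF vertices(7)]] by blast
  have uk: "g (u k) = ?P m"
  proof (rule eq_arrangement_by_elimination[OF f cg[OF vertices(3)[OF index[OF k(1)]]]])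
    fix i assume i: "i \<in> {1..<m}" 
    show "g (u k) \<noteq> ?P i"
    proof (cases "i = k")
      case True
      then show ?thesis using arc_avoids(2)[OF fg u_w[OF index[OF k(1)]]] k(2) by simp
    next
      case False
      then show ?thesis
        using arc_avoids(2)[OF fg u_v[OF index[OF k(1)] index[OF i]]] P[OF i] by auto
    qed
  qed simp
  have only_k: "f (v' i) \<noteq> ?P m" if "i \<in> {1..<m}" "i \<noteq> k" for i
    using arc_avoids(2)[OF fg u_v'[OF index[OF k(1)] index[OF that(1)]]] that(2) uk by auto
  then have fk: "f (v' k) = ?P m" using a by blast
  have "g y = ?P k"
  proof (rule eq_arrangement_by_elimination[OF f cg[OF vertices(6)]])
    fix i assume i: "i \<in> {1..<m}" "i \<noteq> k"
    show "g y \<noteq> ?P i"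
      using arc_avoids(2)[OF fg y_v'[OF index[OF i(1)]]] fv'[OF i(1)] only_k[OF i] by auto
  next
    show "g y \<noteq> ?P m" using arc_avoids(2)[OF fg y_v'[OF index[OF k(1)]]] fk by simp
  qed
  then show False using arc_avoids(2)[OF fg y_w] k(2) by simp
qed

lemma eq_if_agree_below:
  assumes P: "P permutes {1..m}" and Q: "Q permutes {1..m}"
    and eq: "\<And>i. i \<in> {1..<m} \<Longrightarrow> Q i = P i"
  shows "Q = P"
proof
  fix i
  have m: "m \<in> {1..m}" using three_le_m by simp
  have "P m \<in> Q ` {1..m}" using permutes_image[OF Q] permutes_in_image[OF P] m by simp
  then obtain j where j: "j \<in> {1..m}" "P m = Q j" by blast
  have "j = m"
  proof (rule ccontr)
    assume "j \<noteq> m"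
    then have "P m = P j" using eq[of j] j by simp
    then show False using permutes_inj[OF P] \<open>j \<noteq> m\<close> by (simp add: inj_eq)
  qed
  then have "Q m = P m" using j by simp
  moreover have "i \<in> {1..<m} \<or> i = m \<or> i \<notin> {1..m}" by auto
  ultimately show "Q i = P i" using eq permutes_not_in[OF P] permutes_not_in[OF Q] by metis
qed

text \<open>
  The value \<open>g (v j)\<close> avoids \<open>f (v i)\<close> for all \<open>i \<noteq> j\<close>, so it is \<open>f (v j)\<close> or the hole
  of \<open>f\<close>. Injectivity of \<open>g\<close> allows at most one value to move into the hole.
\<close>

lemma arrangement_step:
  assumes fg: "(f, g) \<in> parcs K" and f: "clash_free f" and g: "clash_free g"
  obtains (stay) "arrangement g = arrangement f"
  | (slide) j where "j \<in> {1..<m}" "arrangement g = arrangement f \<circ> transpose j m"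
proof -
  let ?P = "arrangement f" and ?Q = "arrangement g"
  note perm = arrangement(1)[OF f] arrangement(1)[OF g]
  have step: "?Q j = ?P j \<or> ?Q j = ?P m" if j: "j \<in> {1..<m}" for j
  proof (rule ccontr)
    assume *: "\<not> ?thesis"
    have "?Q j = ?P j"
    proof (rule eq_arrangement_by_elimination[OF f])
      show "?Q j \<in> {1..m}" using permutes_in_image[OF perm(2)] j by simp
      fix i assume i: "i \<in> {1..<m}" "i \<noteq> j"
      show "?Q j \<noteq> ?P i"
        using arc_avoids(1)[OF fg v_v[OF index[OF i(1)] index[OF j] i(2)]]
          arrangement(2)[OF f i(1)] arrangement(2)[OF g j] by simp
    qed (use * in simp)
    with * show False by simp
  qed
  show thesis
  proof (cases "\<exists>j\<in>{1..<m}. ?Q j \<noteq> ?P j")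
    case False
    then show thesis using stay eq_if_agree_below[OF perm] by blast
  next
    case True
    then obtain j where j: "j \<in> {1..<m}" "?Q j = ?P m" using step by blast
    have tr: "transpose j m permutes {1..m}" using j(1) by (intro permutes_swap_id) auto
    have "?Q = ?P \<circ> transpose j m"
    proof (rule eq_if_agree_below[OF permutes_compose[OF tr perm(1)] perm(2)])
      fix i assume i: "i \<in> {1..<m}"
      show "?Q i = (?P \<circ> transpose j m) i"
      proof (cases "i = j")
        case True
        then show ?thesis using j by simp
      next
        case False
        have "?Q i \<noteq> ?Q j" using permutes_inj[OF perm(2)] False by (simp add: inj_eq)
        then have "?Q i = ?P i" using step[OF i] j by auto
        then show ?thesis using False i by (simp add: transpose_apply_other)
      qed
    qed
    then show thesis using slide j(1) by blast
  qed
qed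

text \<open>
  After a slide from \<open>v j\<close>, the hole of \<open>g\<close> is \<open>f (v j)\<close>, which \<open>g\<close> cannot take at a copy other
  than \<open>v' j\<close>. If \<open>g\<close> were unfaithful, it would take it at \<open>v' j\<close>, and then \<open>g\<close> would
  carry the values of \<open>f\<close> on all of \<open>v'\<close>.
\<close>

lemma slide_faithful:
  assumes fg: "(f, g) \<in> parcs K" and f: "clash_free f" and g: "clash_free g"
    and j: "j \<in> {1..<m}" and eq: "arrangement g = arrangement f \<circ> transpose j m"
    and ff: "faithful f"
  shows "faithful g"
proof (rule ccontr)
  assume ng: "\<not> faithful g"
  let ?P = "arrangement f"
  note P = arrangement(2)[OF f] and Q = arrangement(2)[OF g]
  have gv: "g (v i) = (if i = j then ?P m else ?P i)" if "i \<in> {1..<m}" for i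
    using Q[OF that] that by (auto simp: eq)
  have Qm: "arrangement g m = ?P j" by (simp add: eq)
  have others: "g (v' i) = f (v i)" if i: "i \<in> {1..<m}" "i \<noteq> j" for i
  proof -
    have "g (v' i) \<noteq> ?P j"
      using arc_avoids(2)[OF fg v'_v[OF index[OF i(1)] index[OF j] i(2)]] P[OF j] by simp
    then show ?thesis using clash_free_copy[OF g i(1)] Qm gv[OF i(1)] i P[OF i(1)] by simp
  qed
  \<comment> \<open>Unfaithfulness of \<open>g\<close> can only show at \<open>v' j\<close>.\<close>
  have "g (v' j) = f (v j)"
  proof -
    have "g (v' j) \<noteq> g (v j)"
    proof
      assume "g (v' j) = g (v j)"
      moreover have "g (v' i) = g (v i)" if "i \<in> {1..<m}" "i \<noteq> j" for i
        using others[OF that] gv[OF that(1)] that P[OF that(1)] by simp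
      ultimately show False using ng unfolding faithful_def by metis
    qed
    then show ?thesis using clash_free_copy[OF g j] Qm P[OF j] by simp
  qed
  with others have "g (v' i) = f (v i)" if "i \<in> {1..<m}" for i using that by metis
  then show False using no_arc_if_copies_unmoved[OF fg f] ff unfolding faithful_def by blast
qed

text \<open>
  Without a slide the parity is kept and faithfulness changes; with a slide it is the other way round.
\<close>

lemma clash_free_arc_side:
  assumes fg: "(f, g) \<in> parcs K" and f: "clash_free f" and g: "clash_free g"
  shows "(evenperm (arrangement f) = faithful f) \<noteq> (evenperm (arrangement g) = faithful g)"
  using fg f g
proof (cases rule: arrangement_step)
  case stay
  have "f (v i) = g (v i)" if "i \<in> {1..<m}" for i
    using arrangement(2)[OF f that] arrangement(2)[OF g that] stay by simp
  then have "\<not> (faithful f \<and> faithful g)"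
    using no_arc_if_copies_unmoved[OF fg f] unfolding faithful_def by metis
  moreover have "faithful f \<or> faithful g"
    using no_arc_if_both_unfaithful[OF fg f g stay] by blast
  ultimately show ?thesis using stay by auto
next
  case (slide j)
  have "permutation (arrangement f)"
    using arrangement(1)[OF f] by (auto simp: permutation_permutes)
  moreover have "j \<noteq> m" using slide(1) by simp
  ultimately have "evenperm (arrangement g) \<noteq> evenperm (arrangement f)"
    using slide(2) by (simp add: evenperm_comp permutation_swap_id evenperm_swap)
  moreover have "arrangement f = arrangement g \<circ> transpose j m"
    using slide(2) by (simp add: comp_assoc)
  then have "faithful f = faithful g"
    using slide_faithful[OF fg f g slide] slide_faithful[OF arc_flip[OF fg] g f slide(1)] by blast
  ultimately show ?thesis by auto
qed

lemma colouring_proper: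
  assumes fg: "(f, g) \<in> parcs K"
  shows "colouring f \<noteq> colouring g"
proof -
  have clash: "colouring f \<noteq> colouring g" if "(f, g) \<in> parcs K" "\<exists>c. clash f c" for f g
  proof -
    have "clash f (colouring f)" using that(2) unfolding colouring_def by (simp add: someI_ex)
    then show ?thesis
      using clash_avoided[OF that(1)] colouring_clique_colour[of g] by metis
  qed
  show ?thesis
  proof (cases "(\<exists>c. clash f c) \<or> (\<exists>c. clash g c)")
    case True
    then show ?thesis using clash[OF fg] clash[OF arc_flip[OF fg]] by metis
  next
    case False
    then have cf: "clash_free f" "clash_free g"
      using arc_vertices[OF fg] by (auto simp: clash_free_def)
    have 12: "(1::nat) \<in> {1..n}" "(2::nat) \<in> {1..n}" using two_le_n by auto
    have "f (v 1) \<noteq> g (v 2)" "f (v 2) \<noteq> g (v 1)"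
      using arc_avoids[OF fg v_v[OF 12]] by simp_all
    then show ?thesis
      using clash_free_arc_side[OF fg cf] False by (auto simp: colouring_def)
  qed
qed

lemma colouring_hom: "graph_hom colouring K (complete_graph m)"
proof -
  have range: "colouring f \<in> {1..m}" if "f \<in> pverts K" for f
  proof -
    obtain i where i: "i \<in> {1..<m}" "colouring f = f (v i)" using colouring_clique_colour by metis
    show ?thesis unfolding i(2) by (rule colour_in[OF that vertices(1)[OF index[OF i(1)]]])
  qed
  show ?thesis
    unfolding graph_hom_def complete_graph_simps(1)
  proof (intro conjI allI impI)
    show "colouring \<in> pverts K \<rightarrow> {1..m}" using range by (rule Pi_I)
    fix f g assume fg: "(f, g) \<in> parcs K"
    have "f \<in> pverts K" "g \<in> pverts K" using arc_vertices[OF fg] by blast+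
    then show "(colouring f, colouring g) \<in> parcs (complete_graph m)"
      unfolding complete_graph_simps(2) using colouring_proper[OF fg] range by blast
  qed
qed

end

context double_mycielskian_of_clique
begin

lemma exp_graph_K1_hom: "graph_hom (\<lambda>_. 1) (exp_graph (complete_graph 1) G) (complete_graph 1)"
proof -
  have "(f, g) \<notin> parcs (exp_graph (complete_graph 1) G)" for f g
    using exp_graph_arcD(3)[OF _ y_w, of f g "complete_graph 1"] by auto
  then show ?thesis by (auto simp: graph_hom_def)
qed

text \<open>
  With two colours, adjacent \<open>f\<close> and \<open>g\<close> take opposite values at adjacent vertices. Following this
  along the 5-cycle \<open>v 1\<close>, \<open>v 2\<close>, \<open>v' 1\<close>, \<open>z\<close>, \<open>v' 2\<close> back to \<open>v 1\<close> shows that they differ at \<open>v 1\<close>.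
\<close>

lemma exp_graph_K2_hom:
  "graph_hom (\<lambda>f. f (v 1)) (exp_graph (complete_graph 2) G) (complete_graph 2)"
proof -
  have 12: "(1::nat) \<in> {1..n}" "(2::nat) \<in> {1..n}" using two_le_n by auto
  have "f (v 1) \<noteq> g (v 1)" if fg: "(f, g) \<in> parcs (exp_graph (complete_graph 2) G)" for f g
  proof -
    have opp: "f x \<in> {1, 2} \<and> g x' \<in> {1, 2} \<and> f x \<noteq> g x'" if "(x, x') \<in> parcs G" for x x'
      using exp_graph_arcD(3)[OF fg that] by auto
    have same: "f x = f x''" if "(x, x') \<in> parcs G" "(x'', x') \<in> parcs G" for x x' x''
      using opp[OF that(1)] opp[OF that(2)] by auto
    have "f (v 1) = f (v' 1)" using same[OF v_v v'_v, of 1 2 1] 12 by simp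
    also have "\<dots> = f (v' 2)" using same[OF v'_z v'_z] 12 by blast
    finally show ?thesis using opp[OF v'_v[OF 12(2) 12(1)]] by simp
  qed
  moreover have range: "f (v 1) \<in> {1..2}"
    if "f \<in> pverts (exp_graph (complete_graph 2) G)" for f
    using that vertices(1)[OF 12(1)] unfolding pverts_exp_graph complete_graph_simps(1)
    by (rule PiE_mem)
  moreover have "f (v 1) \<in> {1..2} \<and> g (v 1) \<in> {1..2}"
    if "(f, g) \<in> parcs (exp_graph (complete_graph 2) G)" for f g
    using exp_graph_arcD(1,2)[OF that] range unfolding pverts_exp_graph by blast
  ultimately show ?thesis
    unfolding graph_hom_def complete_graph_simps by blast
qed

lemma chromatic_number_exp_graph:
  assumes "1 \<le> m" "m \<le> n + 1"
  shows "chromatic_number (exp_graph (complete_graph m) G) = enat m"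
proof -
  have wf: "pair_wf_digraph G" by unfold_locales
  have "\<exists>F. graph_hom F (exp_graph (complete_graph m) G) (complete_graph m)"
  proof -
    consider "m = 1" | "m = 2" | "3 \<le> m" using assms(1) by linarith
    then show ?thesis
    proof cases
      case 3
      then interpret clique_exponential G n v v' u u' z y w m
        using assms(2) by unfold_locales
      show ?thesis using colouring_hom by blast
    qed (use exp_graph_K1_hom exp_graph_K2_hom in blast)+
  qed
  then show ?thesis using chromatic_number_eqI exp_graph_colours_ge[OF wf] by blast
qed

end

theorem theorem1p7:
  fixes n m :: nat and G H :: "'a pair_pre_digraph"
  assumes "n \<ge> 2"
    and "pair_pseudo_graph G"
    and "subgraph (with_proj H) (with_proj G)"
    and "digraph_iso (with_proj (mycielskian (mycielskian (complete_graph n)))) (with_proj H)"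
    and "1 \<le> m" and "m \<le> n + 1"
  shows "chromatic_number (exp_graph (complete_graph m) G) = enat m"
proof -
  let ?MM = "mycielskian (mycielskian (complete_graph n))"
  obtain h where h: "pre_digraph.digraph_isomorphism (with_proj ?MM) h"
    and H: "with_proj H = app_iso h (with_proj ?MM)"
    using assms(4) unfolding digraph_iso_def by blast
  have tail: "iso_tail h = fst" and head: "iso_head h = snd"
    and arcs: "parcs H = iso_arcs h ` parcs ?MM"
    using arg_cong[OF H, of tail] arg_cong[OF H, of head] arg_cong[OF H, of arcs] by simp_all
  have "(iso_verts h s, iso_verts h t) \<in> parcs G" if "(s, t) \<in> parcs ?MM" for s t
  proof -
    have "iso_verts h s = fst (iso_arcs h (s, t))" "iso_verts h t = snd (iso_arcs h (s, t))"
      using h that unfolding pre_digraph.digraph_isomorphism_def tail head by force+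
    then have "(iso_verts h s, iso_verts h t) = iso_arcs h (s, t)" by simp
    then show ?thesis using that arcs assms(3) by (auto simp: subgraph_def)
  qed
  then interpret double_mycielskian_of_clique G n
    "\<lambda>i. iso_verts h (base_vertex (base_vertex i))" "\<lambda>i. iso_verts h (base_vertex (copy_vertex i))"
    "\<lambda>i. iso_verts h (copy_vertex (base_vertex i))" "\<lambda>i. iso_verts h (copy_vertex (copy_vertex i))"
    "iso_verts h (base_vertex (apex (complete_graph n)))"
    "iso_verts h (copy_vertex (apex (complete_graph n)))"
    "iso_verts h (apex (mycielskian (complete_graph n)))"
    using assms(1,2) by (intro double_mycielskian_of_cliqueI)
  show ?thesis using assms(5,6) by (rule chromatic_number_exp_graph)
qed

end
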